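(* Let $(b|g;f_1,f_2)=(d_{n,k})_{n,k\ge0}$ be a double almost-Riordan array with $b(t)=\sum_{k\ge0}b_{2k}t^{2k}$, $g(t)=\sum_{k\ge0}g_{2k}t^{2k}$, $f_1(t)=\sum_{k\ge0}f_{1,2k+1}t^{2k+1}$, $f_2(t)=\sum_{k\ge0}f_{2,2k+1}t^{2k+1}$, and let its compression be $(\hat d_{n,k})_{n\ge k\ge0}$ with $\hat d_{n,k}=d_{2n-k,k}$. Put $\hat b(t)=\sum_kb_{2k}t^k$, $\hat g(t)=\sum_kg_{2k}t^k$, $\hat f_1(t)=\sum_kf_{1,2k+1}t^{k+1}$, $\hat f_2(t)=\sum_kf_{2,2k+1}t^{k+1}$. Then $\hat d_{n,0}=[t^n]\hat b(t)$, and for $k\ge1$ $$\hat d_{n,k}=\begin{cases}[t^n]\,t\hat g\,(\hat f_1\hat f_2)^{(k-1)/2}, & k \text{ odd},\\ [t^n]\,t\hat g\,\hat f_1(\hat f_1\hat f_2)^{(k-2)/2}, & k\text{ even}.\end{cases}$$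
   Context: Over a field of characteristic $0$, with $b_0,g_0,f_{1,1},f_{2,1}\neq0$, the double almost-Riordan array $(b|g;f_1,f_2)$ is the infinite lower triangular matrix $(d_{n,k})$ whose $k$-th column has generating function $b$ for $k=0$, $tg(f_1f_2)^{\ell}$ for $k=2\ell+1$, and $tgf_1(f_1f_2)^{\ell}$ for $k=2\ell+2$. *)

theory Defs
  imports "HOL-Computational_Algebra.Formal_Power_Series"
begin

text \<open>Admissible data: \<open>f1\<close> and \<open>f2\<close> have order exactly one, which is what makes the
  array lower triangular.\<close>

definition double_almost_Riordan ::
  "'a::field_char_0 fps \<Rightarrow> 'a fps \<Rightarrow> 'a fps \<Rightarrow> 'a fps \<Rightarrow> bool" where
  "double_almost_Riordan b g f1 f2 \<longleftrightarrow>
     fps_nth b 0 \<noteq> 0 \<and> fps_nth g 0 \<noteq> 0 \<and>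
     fps_nth f1 0 = 0 \<and> fps_nth f1 1 \<noteq> 0 \<and>
     fps_nth f2 0 = 0 \<and> fps_nth f2 1 \<noteq> 0"

definition dar_column ::
  "'a::field_char_0 fps \<Rightarrow> 'a fps \<Rightarrow> 'a fps \<Rightarrow> 'a fps \<Rightarrow> nat \<Rightarrow> 'a fps" where
  "dar_column b g f1 f2 k =
     (if k = 0 then b
      else if odd k then fps_X * g * (f1 * f2) ^ ((k - 1) div 2)
      else fps_X * g * f1 * (f1 * f2) ^ ((k - 2) div 2))"

definition dar_array ::
  "'a::field_char_0 fps \<Rightarrow> 'a fps \<Rightarrow> 'a fps \<Rightarrow> 'a fps \<Rightarrow> nat \<Rightarrow> nat \<Rightarrow> 'a" where
  "dar_array b g f1 f2 n k = fps_nth (dar_column b g f1 f2 k) n"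

text \<open>Meaningful only for \<open>k \<le> n\<close>; outside this range the subtraction may truncate.\<close>

definition compression :: "(nat \<Rightarrow> nat \<Rightarrow> 'a) \<Rightarrow> nat \<Rightarrow> nat \<Rightarrow> 'a" where
  "compression d n k = d (2 * n - k) k"

text \<open>\<open>hat_even\<close> sends \<open>\<Sum>k. a(2k) t^(2k)\<close> to \<open>\<Sum>k. a(2k) t^k\<close>, and \<open>hat_odd\<close> sends
  \<open>\<Sum>k. a(2k+1) t^(2k+1)\<close> to \<open>\<Sum>k. a(2k+1) t^(k+1)\<close>.\<close>

definition hat_even :: "'a::field_char_0 fps \<Rightarrow> 'a fps" where
  "hat_even a = Abs_fps (\<lambda>k. fps_nth a (2 * k))"

definition hat_odd :: "'a::field_char_0 fps \<Rightarrow> 'a fps" where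
  "hat_odd a = Abs_fps (\<lambda>m. case m of 0 \<Rightarrow> 0 | Suc k \<Rightarrow> fps_nth a (2 * k + 1))"

end

theory Submission
  imports Defs "HOL-Computational_Algebra.Formal_Laurent_Series"
begin

text \<open>Substituting \<open>t\<^sup>2\<close> for \<open>t\<close> is a ring homomorphism which sends \<open>hat_even a\<close> to \<open>a\<close> for even \<open>a\<close>
  and \<open>hat_odd a\<close> to \<open>t a\<close> for odd \<open>a\<close>. Column \<open>k\<close> of the array contains \<open>k - 1\<close> odd factors and
  one factor \<open>t\<close>, so multiplying it by \<open>t\<^sup>k\<close> turns it into the image of the claimed column of the
  compression; the coefficients of \<open>t\<^bsup>2n\<^esup>\<close> then agree.\<close>

lemma hat_even_compose_X_squared:
  assumes "\<And>m. odd m \<Longrightarrow> fps_nth a m = 0"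
  shows "hat_even a oo fps_X ^ 2 = a"
  by (rule fps_ext) (auto simp: fps_nth_compose_X_power hat_even_def assms)

text \<open>An exponent \<open>2k+1\<close> first becomes \<open>k+1\<close> and is then doubled to
  \<open>2k+2\<close>, one more than at the start; hence the factor \<open>fps_X\<close>.\<close>

lemma hat_odd_compose_X_squared:
  assumes "\<And>m. even m \<Longrightarrow> fps_nth a m = 0"
  shows "hat_odd a oo fps_X ^ 2 = fps_X * a"
proof (rule fps_ext)
  fix n
  show "fps_nth (hat_odd a oo fps_X ^ 2) n = fps_nth (fps_X * a) n"
  proof (cases n)
    case (Suc m)
    show ?thesis
    proof (cases "even n")
      case True
      then obtain j where "n = 2 * Suc j"
        using Suc by (metis dvdE mult_0_right nat.exhaust nat.distinct(1))
      then show ?thesis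
        by (simp add: fps_nth_compose_X_power hat_odd_def)
    next
      case False
      then show ?thesis
        using Suc assms by (simp add: fps_nth_compose_X_power)
    qed
  qed (simp add: fps_nth_compose_X_power hat_odd_def)
qed

text \<open>Compare coefficients at \<open>2 * n\<close>. The bound on \<open>k\<close> keeps
  \<open>2 * n - k\<close> from truncating.\<close>

lemma nth_eq_if_compose_X_squared_eq:
  fixes c h :: "'a::field_char_0 fps"
  assumes "h oo fps_X ^ 2 = fps_X ^ k * c" and "k \<le> 2 * n"
  shows "fps_nth c (2 * n - k) = fps_nth h n"
proof -
  have "fps_nth h n = fps_nth (h oo fps_X ^ 2) (2 * n)"
    by (simp add: fps_nth_compose_X_power)
  also have "\<dots> = fps_nth c (2 * n - k)"
    using assms by (simp add: fps_X_power_mult_nth)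
  finally show ?thesis ..
qed

theorem theorem4p1:
  fixes b g f1 f2 :: "'a::field_char_0 fps"
    and d :: "nat \<Rightarrow> nat \<Rightarrow> 'a"
  assumes "double_almost_Riordan b g f1 f2"
    and "d = dar_array b g f1 f2"
    and "\<forall>m. odd m \<longrightarrow> fps_nth b m = 0"
    and "\<forall>m. odd m \<longrightarrow> fps_nth g m = 0"
    and "\<forall>m. even m \<longrightarrow> fps_nth f1 m = 0"
    and "\<forall>m. even m \<longrightarrow> fps_nth f2 m = 0"
  shows "(\<forall>n. compression d n 0 = fps_nth (hat_even b) n) \<and>
    (\<forall>n k. 1 \<le> k \<and> k \<le> n \<longrightarrow>
       compression d n k =
         (if odd k
          then fps_nth (fps_X * hat_even g * (hat_odd f1 * hat_odd f2) ^ ((k - 1) div 2)) n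
          else fps_nth (fps_X * hat_even g * hat_odd f1 *
                          (hat_odd f1 * hat_odd f2) ^ ((k - 2) div 2)) n))"
proof (intro conjI allI impI)
  fix n
  \<comment> \<open>For column 0 the compression reads row \<open>2 * n\<close>, exactly as
    \<open>hat_even\<close> does.\<close>
  show "compression d n 0 = fps_nth (hat_even b) n"
    by (simp add: assms(2) compression_def dar_array_def dar_column_def hat_even_def)
next
  fix n k :: nat
  assume k: "1 \<le> k \<and> k \<le> n"
  let ?F = "hat_odd f1 * hat_odd f2"
  have g: "hat_even g oo fps_X ^ 2 = g"
    using assms(4) by (intro hat_even_compose_X_squared) auto
  have f: "hat_odd f1 oo fps_X ^ 2 = fps_X * f1" "hat_odd f2 oo fps_X ^ 2 = fps_X * f2"
    using assms(5,6) by (auto intro!: hat_odd_compose_X_squared)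
  note distrib = fps_compose_mult_distrib fps_compose_power[symmetric] g f
  show "compression d n k =
         (if odd k
          then fps_nth (fps_X * hat_even g * ?F ^ ((k - 1) div 2)) n
          else fps_nth (fps_X * hat_even g * hat_odd f1 * ?F ^ ((k - 2) div 2)) n)"
  proof (cases "odd k")
    case True
    then obtain l where l: "k = 2 * l + 1" by (elim oddE)
    \<comment> \<open>The leading \<open>fps_X\<close> becomes \<open>fps_X ^ 2\<close> and each of
      the \<open>l\<close> pairs adds another: \<open>2l+2 = k+1\<close> factors, one of which stays
      in the column.\<close>
    have "(fps_X * hat_even g * ?F ^ l) oo fps_X ^ 2
        = fps_X ^ k * (fps_X * g * (f1 * f2) ^ l)"
      by (simp add: distrib) (simp add: l power_mult_distrib power_mult power2_eq_square mult_ac)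
    then have "fps_nth (fps_X * g * (f1 * f2) ^ l) (2 * n - k)
        = fps_nth (fps_X * hat_even g * ?F ^ l) n"
      using k by (intro nth_eq_if_compose_X_squared_eq) auto
    then show ?thesis
      by (simp add: assms(2) compression_def dar_array_def dar_column_def l)
  next
    case False
    then obtain j where "k = 2 * j" by (auto elim: evenE)
    with k obtain l where l: "k = 2 * l + 2" by (cases j) auto
    \<comment> \<open>The extra \<open>hat_odd f1\<close> gives one more factor:
      \<open>2l+3\<close>, again \<open>k+1\<close>.\<close>
    have "(fps_X * hat_even g * hat_odd f1 * ?F ^ l) oo fps_X ^ 2
        = fps_X ^ k * (fps_X * g * f1 * (f1 * f2) ^ l)"
      by (simp add: distrib)
        (simp add: l power_mult_distrib power_mult power_add power2_eq_square mult_ac)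
    then have "fps_nth (fps_X * g * f1 * (f1 * f2) ^ l) (2 * n - k)
        = fps_nth (fps_X * hat_even g * hat_odd f1 * ?F ^ l) n"
      using k by (intro nth_eq_if_compose_X_squared_eq) auto
    then show ?thesis
      by (simp add: assms(2) compression_def dar_array_def dar_column_def l)
  qed
qed

end
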